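(* The admissible set $$\mathcal{A} = \{ \bar{x} \in \mathcal{G} \mid \exists\, u \in \mathcal{U} : x^{(\bar{x},u)}(t) \in \mathcal{G} \ \ \forall t \geq 0 \}$$ of the linear system $\dot x(t)=Ax(t)+Bu(t)$ subject to the affine state constraints $H_ix(t)+h_i\le0$, $i=1,\dots,p$, is convex.
   Context: $A\in\mathbb{R}^{n\times n}$, $B\in\mathbb{R}^{n\times m}$; $\mathbb{U}\subset\mathbb{R}^m$ is nonempty, convex and compact; $\mathcal{U}$ is the set of Lebesgue-measurable functions $u:[0,\infty)\to\mathbb{U}$. For $x_0\in\mathbb{R}^n$ and $u\in\mathcal{U}$, $x^{(x_0,u)}$ denotes the absolutely continuous solution of $\dot x(t)=Ax(t)+Bu(t)$, $x(0)=x_0$. $H\in\mathbb{R}^{p\times n}$ has rows $H_1,\dots,H_p$, all nonzero, and $h\in\mathbb{R}^p$ has components $h_1,\dots,h_p$. $\mathcal{G}=\{x\in\mathbb{R}^n\mid H_ix+h_i\le 0 \text{ for all } i=1,\dots,p\}$ is assumed to have nonempty interior, and the set $\{x\in\mathbb{R}^n \mid \exists\, i: H_ix+h_i=0\}$ is assumed nonempty. *)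

theory Defs
  imports "HOL-Analysis.Analysis"
begin

(* The usual epsilon-delta notion for functions of one real variable; the library constant
   absolutely_continuous is about measures. A pair (a, b) in D stands for the interval from a to b. *)
definition abs_continuous_on :: "real set \<Rightarrow> (real \<Rightarrow> 'a::metric_space) \<Rightarrow> bool" where
  "abs_continuous_on I f \<longleftrightarrow>
     (\<forall>\<epsilon>>0. \<exists>\<delta>>0. \<forall>D.
        finite D \<and> (\<forall>(a, b)\<in>D. a \<le> b \<and> {a..b} \<subseteq> I) \<and>
        disjoint_family_on (\<lambda>(a, b). {a<..<b}) D \<and>
        (\<Sum>(a, b)\<in>D. b - a) < \<delta>
        \<longrightarrow> (\<Sum>(a, b)\<in>D. dist (f a) (f b)) < \<epsilon>)"

(* Functions on the half line are total functions whose values at negative times are ignored. *)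
definition controls :: "(real ^ 'm) set \<Rightarrow> (real \<Rightarrow> real ^ 'm) set" where
  "controls U = {u. u \<in> borel_measurable (lebesgue_on {0..}) \<and> (\<forall>t\<ge>0. u t \<in> U)}"

(* Solution in the sense of Caratheodory: x is absolutely continuous on every compact time
   interval (global absolute continuity would exclude, e.g., exponential growth) and satisfies the
   differential equation almost everywhere. For a control u with values in a bounded set such an
   x exists and is unique on {0..}, so this relation says that x is the solution for (x0, u). *)
definition is_solution ::
  "real ^ 'n ^ 'n \<Rightarrow> real ^ 'm ^ 'n \<Rightarrow> real ^ 'n \<Rightarrow> (real \<Rightarrow> real ^ 'm) \<Rightarrow> (real \<Rightarrow> real ^ 'n) \<Rightarrow> bool"
  where
  "is_solution A B x0 u x \<longleftrightarrow>
     (\<forall>T\<ge>0. abs_continuous_on {0..T} x) \<and>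
     (AE t in lebesgue_on {0..}. (x has_vector_derivative (A *v x t + B *v u t)) (at t within {0..})) \<and>
     x 0 = x0"

definition constraint_set :: "real ^ 'n ^ 'p \<Rightarrow> real ^ 'p \<Rightarrow> (real ^ 'n) set" where
  "constraint_set H h = {x. \<forall>i. row i H \<bullet> x + h $ i \<le> 0}"

definition admissible_set ::
  "real ^ 'n ^ 'n \<Rightarrow> real ^ 'm ^ 'n \<Rightarrow> (real ^ 'm) set \<Rightarrow> real ^ 'n ^ 'p \<Rightarrow> real ^ 'p \<Rightarrow> (real ^ 'n) set"
  where
  "admissible_set A B U H h =
     {xbar \<in> constraint_set H h.
        \<exists>u\<in>controls U. \<exists>x. is_solution A B xbar u x \<and> (\<forall>t\<ge>0. x t \<in> constraint_set H h)}"

end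

theory Submission
  imports Defs
begin

text \<open>
  The dynamics are jointly linear in state and control. If \<open>x\<close> solves the initial value
  problem for \<open>(x0, u)\<close> and \<open>y\<close> solves it for \<open>(y0, v)\<close>, then a convex combination of the two
  trajectories is the trajectory that starts in the same combination of \<open>x0\<close> and \<open>y0\<close> under
  the same combination of \<open>u\<close> and \<open>v\<close> (\<open>is_solution_linear_combination\<close>). The combined control
  is again admissible because the control values lie in a convex set (\<open>controls_convex\<close>), and
  the combined trajectory stays in the constraint set because that set, an intersection of
  half-spaces, is convex (\<open>convex_constraint_set\<close>).
\<close>

lemma abs_continuous_on_add:
  fixes f g :: "real \<Rightarrow> 'a::real_normed_vector"
  assumes f: "abs_continuous_on I f" and g: "abs_continuous_on I g"
  shows "abs_continuous_on I (\<lambda>t. f t + g t)"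
  unfolding abs_continuous_on_def
proof (intro allI impI)
  fix e :: real
  assume "e > 0"
  then have e2: "e / 2 > 0" by simp
  obtain d1 where d1: "d1 > 0"
    and D1: "\<And>D. finite D \<and> (\<forall>(a, b)\<in>D. a \<le> b \<and> {a..b} \<subseteq> I) \<and>
        disjoint_family_on (\<lambda>(a, b). {a<..<b}) D \<and> (\<Sum>(a, b)\<in>D. b - a) < d1
        \<Longrightarrow> (\<Sum>(a, b)\<in>D. dist (f a) (f b)) < e / 2"
    using f e2 unfolding abs_continuous_on_def by blast
  obtain d2 where d2: "d2 > 0"
    and D2: "\<And>D. finite D \<and> (\<forall>(a, b)\<in>D. a \<le> b \<and> {a..b} \<subseteq> I) \<and>
        disjoint_family_on (\<lambda>(a, b). {a<..<b}) D \<and> (\<Sum>(a, b)\<in>D. b - a) < d2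
        \<Longrightarrow> (\<Sum>(a, b)\<in>D. dist (g a) (g b)) < e / 2"
    using g e2 unfolding abs_continuous_on_def by blast
  show "\<exists>\<delta>>0. \<forall>D. finite D \<and> (\<forall>(a, b)\<in>D. a \<le> b \<and> {a..b} \<subseteq> I) \<and>
        disjoint_family_on (\<lambda>(a, b). {a<..<b}) D \<and> (\<Sum>(a, b)\<in>D. b - a) < \<delta>
        \<longrightarrow> (\<Sum>(a, b)\<in>D. dist (f a + g a) (f b + g b)) < e"
  proof (intro exI[of _ "min d1 d2"] conjI allI impI)
    show "min d1 d2 > 0" using d1 d2 by simp
    fix D
    assume D: "finite D \<and> (\<forall>(a, b)\<in>D. a \<le> b \<and> {a..b} \<subseteq> I) \<and>
        disjoint_family_on (\<lambda>(a, b). {a<..<b}) D \<and> (\<Sum>(a, b)\<in>D. b - a) < min d1 d2"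
    have "(\<Sum>(a, b)\<in>D. dist (f a + g a) (f b + g b))
        \<le> (\<Sum>(a, b)\<in>D. dist (f a) (f b) + dist (g a) (g b))"
      by (intro sum_mono) (auto simp: dist_triangle_add)
    also have "\<dots> = (\<Sum>(a, b)\<in>D. dist (f a) (f b)) + (\<Sum>(a, b)\<in>D. dist (g a) (g b))"
      by (simp add: case_prod_unfold sum.distrib)
    also have "\<dots> < e / 2 + e / 2"
      using D by (intro add_strict_mono D1 D2) auto
    finally show "(\<Sum>(a, b)\<in>D. dist (f a + g a) (f b + g b)) < e" by simp
  qed
qed

lemma abs_continuous_on_scaleR:
  fixes f :: "real \<Rightarrow> 'a::real_normed_vector"
  assumes f: "abs_continuous_on I f"
  shows "abs_continuous_on I (\<lambda>t. c *\<^sub>R f t)"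
  unfolding abs_continuous_on_def
proof (intro allI impI)
  fix e :: real
  assume e: "e > 0"
  \<comment> \<open>The summand 1 in the denominator covers the case \<open>c = 0\<close>.\<close>
  then have "e / (\<bar>c\<bar> + 1) > 0" by (simp add: add_nonneg_pos)
  then obtain d where d: "d > 0"
    and D: "\<forall>D. finite D \<and> (\<forall>(a, b)\<in>D. a \<le> b \<and> {a..b} \<subseteq> I) \<and>
        disjoint_family_on (\<lambda>(a, b). {a<..<b}) D \<and> (\<Sum>(a, b)\<in>D. b - a) < d
        \<longrightarrow> (\<Sum>(a, b)\<in>D. dist (f a) (f b)) < e / (\<bar>c\<bar> + 1)"
    using f unfolding abs_continuous_on_def by blast
  have "(\<Sum>(a, b)\<in>D. dist (c *\<^sub>R f a) (c *\<^sub>R f b)) < e"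
    if "(\<Sum>(a, b)\<in>D. dist (f a) (f b)) < e / (\<bar>c\<bar> + 1)" for D
  proof -
    let ?S = "\<Sum>(a, b)\<in>D. dist (f a) (f b)"
    have "(\<Sum>(a, b)\<in>D. dist (c *\<^sub>R f a) (c *\<^sub>R f b)) = \<bar>c\<bar> * ?S"
      by (simp add: case_prod_unfold sum_distrib_left dist_norm flip: scaleR_diff_right)
    also have "\<dots> \<le> (\<bar>c\<bar> + 1) * ?S"
      by (intro mult_right_mono sum_nonneg) auto
    also have "\<dots> < e"
      using that by (simp add: pos_less_divide_eq add_nonneg_pos mult.commute)
    finally show ?thesis .
  qed
  with d D show "\<exists>\<delta>>0. \<forall>D. finite D \<and> (\<forall>(a, b)\<in>D. a \<le> b \<and> {a..b} \<subseteq> I) \<and>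
        disjoint_family_on (\<lambda>(a, b). {a<..<b}) D \<and> (\<Sum>(a, b)\<in>D. b - a) < \<delta>
        \<longrightarrow> (\<Sum>(a, b)\<in>D. dist (c *\<^sub>R f a) (c *\<^sub>R f b)) < e"
    by blast
qed

lemma controls_convex:
  assumes "convex U" "u \<in> controls U" "v \<in> controls U" "0 \<le> c" "0 \<le> d" "c + d = 1"
  shows "(\<lambda>t. c *\<^sub>R u t + d *\<^sub>R v t) \<in> controls U"
  using assms unfolding controls_def by (auto intro: convexD)

lemma convex_constraint_set: "convex (constraint_set H h)"
proof -
  have "a + b \<le> 0 \<longleftrightarrow> a \<le> - b" for a b :: real by linarith
  then have "constraint_set H h = (\<Inter>i. {x. row i H \<bullet> x \<le> - (h $ i)})"
    by (auto simp: constraint_set_def)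
  then show ?thesis
    by (auto intro: convex_INT convex_halfspace_le)
qed

text \<open>
  The superposition principle. The differential equation for the combination holds off the
  union of the two null sets on which the equations for \<open>x\<close> and \<open>y\<close> may fail.
\<close>

lemma is_solution_linear_combination:
  assumes x: "is_solution A B x0 u x" and y: "is_solution A B y0 v y"
  shows "is_solution A B (c *\<^sub>R x0 + d *\<^sub>R y0)
    (\<lambda>t. c *\<^sub>R u t + d *\<^sub>R v t) (\<lambda>t. c *\<^sub>R x t + d *\<^sub>R y t)"
  unfolding is_solution_def
proof (intro conjI allI impI)
  show "abs_continuous_on {0..T} (\<lambda>t. c *\<^sub>R x t + d *\<^sub>R y t)" if "T \<ge> 0" for T
    using x y that unfolding is_solution_def
    by (intro abs_continuous_on_add abs_continuous_on_scaleR) auto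
  have "AE t in lebesgue_on {0..}.
      (x has_vector_derivative (A *v x t + B *v u t)) (at t within {0..})"
    using x by (simp add: is_solution_def)
  moreover have "AE t in lebesgue_on {0..}.
      (y has_vector_derivative (A *v y t + B *v v t)) (at t within {0..})"
    using y by (simp add: is_solution_def)
  ultimately show "AE t in lebesgue_on {0..}. ((\<lambda>t. c *\<^sub>R x t + d *\<^sub>R y t) has_vector_derivative
      (A *v (c *\<^sub>R x t + d *\<^sub>R y t) + B *v (c *\<^sub>R u t + d *\<^sub>R v t))) (at t within {0..})"
  proof eventually_elim
    case (elim t)
    have "A *v (c *\<^sub>R x t + d *\<^sub>R y t) + B *v (c *\<^sub>R u t + d *\<^sub>R v t)
        = c *\<^sub>R (A *v x t + B *v u t) + d *\<^sub>R (A *v y t + B *v v t)"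
      by (simp add: matrix_vector_right_distrib matrix_vector_mult_scaleR scaleR_add_right)
    then show ?case
      using elim by (auto intro!: derivative_eq_intros)
  qed
  show "c *\<^sub>R x 0 + d *\<^sub>R y 0 = c *\<^sub>R x0 + d *\<^sub>R y0"
    using x y by (simp add: is_solution_def)
qed

theorem corollary6:
  fixes A :: "real ^ 'n ^ 'n" and B :: "real ^ 'm ^ 'n" and U :: "(real ^ 'm) set"
    and H :: "real ^ 'n ^ 'p" and h :: "real ^ 'p"
  assumes "U \<noteq> {}" and "convex U" and "compact U"
    and "\<And>i. row i H \<noteq> 0"
    and "interior (constraint_set H h) \<noteq> {}"
    and "{x. \<exists>i. row i H \<bullet> x + h $ i = 0} \<noteq> {}"
  shows "convex (admissible_set A B U H h)"
proof (rule convexI)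
  fix x0 y0 :: "real ^ 'n" and c d :: real
  assume x0: "x0 \<in> admissible_set A B U H h" and y0: "y0 \<in> admissible_set A B U H h"
    and cd: "0 \<le> c" "0 \<le> d" "c + d = 1"
  obtain u x where u: "u \<in> controls U" "is_solution A B x0 u x"
      "\<forall>t\<ge>0. x t \<in> constraint_set H h"
    using x0 by (auto simp: admissible_set_def)
  obtain v y where v: "v \<in> controls U" "is_solution A B y0 v y"
      "\<forall>t\<ge>0. y t \<in> constraint_set H h"
    using y0 by (auto simp: admissible_set_def)
  let ?w = "\<lambda>t. c *\<^sub>R u t + d *\<^sub>R v t" and ?z = "\<lambda>t. c *\<^sub>R x t + d *\<^sub>R y t"
  have "c *\<^sub>R x0 + d *\<^sub>R y0 \<in> constraint_set H h"
    using x0 y0 cd by (auto simp: admissible_set_def intro: convexD[OF convex_constraint_set])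
  moreover have "?w \<in> controls U"
    using controls_convex[OF \<open>convex U\<close> u(1) v(1) cd] .
  moreover have "is_solution A B (c *\<^sub>R x0 + d *\<^sub>R y0) ?w ?z"
    using is_solution_linear_combination[OF u(2) v(2)] .
  moreover have "\<forall>t\<ge>0. ?z t \<in> constraint_set H h"
    using u(3) v(3) cd by (auto intro: convexD[OF convex_constraint_set])
  ultimately show "c *\<^sub>R x0 + d *\<^sub>R y0 \<in> admissible_set A B U H h"
    unfolding admissible_set_def by blast
qed

end
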